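(* Let $n\ge2$, let $V_1,\dots,V_m\in\mathbb{C}^{n\times n}$ satisfy $\sum_{i=1}^mV_i^*V_i=I_n$, and let $\Phi(X)=\sum_{i=1}^mV_i^*XV_i$ and $\Psi(X)=\sum_{i=1}^mV_iXV_i^*$ for $X$ in the space of $n\times n$ Hermitian matrices. Then $$\|\Phi\|_H=\|\Psi\|_H^\star=1-\min_{\substack{u,v\in\mathbb{C}^n:\ u^*v=0\\ u^*u=v^*v=1}}\ \min_{\substack{X=(x_1,\dots,x_n)\in\mathbb{C}^{n\times n}\\ XX^*=I_n}}\ \sum_{i=1}^n\min\{u^*\Phi(x_ix_i^* )u,\ v^*\Phi(x_ix_i^* )v\},$$ where $x_1,\dots,x_n$ denote the columns of $X$.
   Context: $\mathbf{S}_n$ is the real vector space of $n\times n$ Hermitian matrices. $\|\Phi\|_H$ is the contraction ratio with respect to the diameter of the spectrum, $$\|\Phi\|_H=\sup_{X\in\mathbf{S}_n\setminus\mathbb{R}I_n}\frac{\lambda_{\max}(\Phi(X))-\lambda_{\min}(\Phi(X))}{\lambda_{\max}(X)-\lambda_{\min}(X)}.$$ $\mathcal{P}(I_n)$ is the set of positive semidefinite Hermitian matrices with trace $1$ (density matrices), $\|X\|_1=\sum_i|\lambda_i(X)|$ is the trace norm, and $$\|\Psi\|_H^\star=\sup_{\rho_1\ne\rho_2\in\mathcal{P}(I_n)}\frac{\|\Psi(\rho_1)-\Psi(\rho_2)\|_1}{\|\rho_1-\rho_2\|_1}.$$ *)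

theory Defs
  imports "HOL-Analysis.Analysis" "HOL-Computational_Algebra.Polynomial"
begin

definition cadjoint :: "complex^'n^'m \<Rightarrow> complex^'m^'n" where
  "cadjoint A = map_matrix cnj (transpose A)"

definition hermitian :: "complex^'n^'n \<Rightarrow> bool" where
  "hermitian A \<longleftrightarrow> cadjoint A = A"

definition cdot :: "complex^'n \<Rightarrow> complex^'n \<Rightarrow> complex" where
  "cdot u v = (\<Sum>i\<in>UNIV. cnj (u $ i) * v $ i)"

definition rank_one :: "complex^'n \<Rightarrow> complex^'n^'n" where
  "rank_one x = (\<chi> i j. x $ i * cnj (x $ j))"

text \<open>The value of \<open>u\<^sup>* A u\<close>; it is only used for Hermitian \<open>A\<close>, where it is real, so that
  taking the real part is merely a change of type.\<close>

definition quad_form :: "complex^'n^'n \<Rightarrow> complex^'n \<Rightarrow> real" where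
  "quad_form A u = Re (cdot u (A *v u))"

definition charpoly :: "complex^'n^'n \<Rightarrow> complex poly" where
  "charpoly A = det (mat [:0, 1:] - map_matrix (\<lambda>a. [:a:]) A)"

text \<open>Eigenvalues counted with algebraic multiplicity.\<close>

definition eigenvalues :: "complex^'n^'n \<Rightarrow> complex multiset" where
  "eigenvalues A = proots (charpoly A)"

text \<open>Extreme eigenvalues, for matrices with real spectrum (Hermitian ones).\<close>

definition lambda_max :: "complex^'n^'n \<Rightarrow> real" where
  "lambda_max A = Max (Re ` set_mset (eigenvalues A))"

definition lambda_min :: "complex^'n^'n \<Rightarrow> real" where
  "lambda_min A = Min (Re ` set_mset (eigenvalues A))"

text \<open>The trace norm of a Hermitian (more generally, normal) matrix.\<close>

definition trace_norm :: "complex^'n^'n \<Rightarrow> real" where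
  "trace_norm A = (\<Sum>z\<in>#eigenvalues A. cmod z)"

definition density_matrices :: "(complex^'n^'n) set" where
  "density_matrices = {\<rho>. hermitian \<rho> \<and> (\<forall>x. 0 \<le> quad_form \<rho> x) \<and> trace \<rho> = 1}"

text \<open>Both contraction ratios are suprema in the extended reals, so that no boundedness
  is presupposed.\<close>

definition hopf_norm :: "(complex^'n^'n \<Rightarrow> complex^'n^'n) \<Rightarrow> ereal" where
  "hopf_norm \<Phi> =
    (SUP X \<in> {X. hermitian X} - range (\<lambda>c::real. c *\<^sub>R mat 1).
       ereal ((lambda_max (\<Phi> X) - lambda_min (\<Phi> X)) / (lambda_max X - lambda_min X)))"

definition hopf_dual_norm :: "(complex^'n^'n \<Rightarrow> complex^'n^'n) \<Rightarrow> ereal" where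
  "hopf_dual_norm \<Psi> =
    (SUP (\<rho>\<^sub>1, \<rho>\<^sub>2) \<in> {(\<rho>\<^sub>1, \<rho>\<^sub>2). \<rho>\<^sub>1 \<in> density_matrices \<and> \<rho>\<^sub>2 \<in> density_matrices \<and> \<rho>\<^sub>1 \<noteq> \<rho>\<^sub>2}.
       ereal (trace_norm (\<Psi> \<rho>\<^sub>1 - \<Psi> \<rho>\<^sub>2) / trace_norm (\<rho>\<^sub>1 - \<rho>\<^sub>2)))"

definition orthonormal_pairs :: "((complex^'n) \<times> (complex^'n)) set" where
  "orthonormal_pairs = {(u, v). cdot u v = 0 \<and> cdot u u = 1 \<and> cdot v v = 1}"

definition unitary_matrices :: "(complex^'n^'n) set" where
  "unitary_matrices = {X. X ** cadjoint X = mat 1}"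

text \<open>A real minimum over an infinite set is rendered as the infimum (\<open>INF\<close>)
  together with the assertion that it is attained.\<close>

definition attains_min_on :: "('a \<Rightarrow> real) \<Rightarrow> 'a set \<Rightarrow> bool" where
  "attains_min_on f S \<longleftrightarrow> (\<exists>x\<in>S. \<forall>y\<in>S. f x \<le> f y)"

definition column_overlap ::
  "(complex^'n^'n \<Rightarrow> complex^'n^'n) \<Rightarrow> complex^'n \<Rightarrow> complex^'n \<Rightarrow> complex^'n^'n \<Rightarrow> real" where
  "column_overlap \<Phi> u v X =
    (\<Sum>i\<in>UNIV. min (quad_form (\<Phi> (rank_one (column i X))) u)
                 (quad_form (\<Phi> (rank_one (column i X))) v))"

definition min_overlap ::
  "(complex^'n^'n \<Rightarrow> complex^'n^'n) \<Rightarrow> (complex^'n) \<times> (complex^'n) \<Rightarrow> real" where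
  "min_overlap \<Phi> = (\<lambda>(u, v). INF X\<in>unitary_matrices. column_overlap \<Phi> u v X)"

end

theory Submission
  imports Defs
begin

text \<open>
  All three quantities are governed by the transition weights
  \<open>w(x, u) = u\<^sup>* \<Phi>(x x\<^sup>* ) u = x\<^sup>* \<Psi>(u u\<^sup>* ) x = \<Sum>i. \<bar>x\<^sup>* V\<^sub>i u\<bar>\<^sup>2\<close>. Since \<open>\<Phi>\<close> is unital, a unit vector \<open>u\<close> and a
  unitary matrix with columns \<open>x\<^sub>k\<close> give a probability distribution \<open>w(x\<^sub>k, u)\<close> in \<open>k\<close>. For orthonormal
  \<open>u\<close> and \<open>v\<close> the overlap \<open>\<Sum>k. min (w(x\<^sub>k, u)) (w(x\<^sub>k, v))\<close> is 1 minus the total variation distance of the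
  two distributions. Let \<open>c\<close> be the largest such distance; it is attained because orthonormal pairs and
  unitary matrices form compact sets. Both contraction ratios equal \<open>c\<close>.

  For \<open>\<Phi>\<close>: with \<open>u\<close>, \<open>v\<close> extreme eigenvectors of \<open>\<Phi>(A)\<close> and \<open>x\<^sub>k\<close> an eigenbasis of \<open>A\<close> with eigenvalues
  \<open>d\<^sub>k\<close>, the diameter of the spectrum of \<open>\<Phi>(A)\<close> is \<open>\<Sum>k. d\<^sub>k (w(x\<^sub>k, u) - w(x\<^sub>k, v))\<close>. The differences
  sum to 0, so the \<open>d\<^sub>k\<close> may be centred at their midrange, which gives at most \<open>c\<close> times the diameter of
  \<open>A\<close> (\<open>diameter_Phi_le\<close>). If \<open>c > 0\<close>, equality occurs for the projection onto the span of the \<open>x\<^sub>k\<close> with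
  \<open>w(x\<^sub>k, u) > w(x\<^sub>k, v)\<close>, for an optimal triple (\<open>gap_le_diameter_ratio\<close>).

  For \<open>\<Psi>\<close>: the trace norm of a Hermitian \<open>B\<close> is the maximum of \<open>\<Sum>k. \<bar>x\<^sub>k\<^sup>* B x\<^sub>k\<bar>\<close> over orthonormal bases, so
  for pure states \<open>u u\<^sup>*\<close> and \<open>v v\<^sup>*\<close>, at distance 2, the largest total variation distance over \<open>X\<close> is the
  contraction ratio of that pair (\<open>gap_le_trace_norm_ratio\<close>). The difference of any two density
  matrices is traceless, hence a nonnegative combination of differences of orthogonal pure states
  without cancellation of mass, so no pair of density matrices does better (\<open>trace_norm_Psi_le\<close>).

  Eigenvalues are defined as roots of the characteristic polynomial; the spectral theorem and
  \<open>eigenvalues_spectral\<close> make them accessible.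
\<close>

section \<open>The sesquilinear form\<close>

lemma cdot_add_right: "cdot u (v + w) = cdot u v + cdot u w"
  by (simp add: cdot_def algebra_simps sum.distrib)

lemma cdot_add_left: "cdot (u + v) w = cdot u w + cdot v w"
  by (simp add: cdot_def algebra_simps sum.distrib)

lemma cdot_scaleR_right: "cdot u (c *\<^sub>R v) = of_real c * cdot u v"
  by (simp add: cdot_def sum_distrib_left scaleR_conv_of_real[where 'a=complex] algebra_simps)

lemma cdot_scaleR_left: "cdot (c *\<^sub>R u) v = of_real c * cdot u v"
  by (simp add: cdot_def sum_distrib_left scaleR_conv_of_real[where 'a=complex] algebra_simps)

lemma cdot_diff_right: "cdot u (v - w) = cdot u v - cdot u w"
  by (simp add: cdot_def algebra_simps sum_subtractf)

lemma cnj_cdot: "cnj (cdot u v) = cdot v u"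
  by (simp add: cdot_def mult.commute)

lemma cmod_cdot_commute: "cmod (cdot u v) = cmod (cdot v u)"
  by (metis cnj_cdot complex_mod_cnj)

lemma cdot_self: "cdot u u = of_real ((norm u)\<^sup>2)"
proof -
  have "(norm u)\<^sup>2 = (\<Sum>i\<in>UNIV. (cmod (u $ i))\<^sup>2)"
    by (simp add: norm_vec_def L2_set_def real_sqrt_pow2 sum_nonneg)
  then show ?thesis
    by (simp add: cdot_def complex_norm_square mult.commute flip: of_real_power)
qed

lemma cdot_self_eq_1_iff: "cdot u u = 1 \<longleftrightarrow> norm u = 1"
proof -
  have "cdot u u = 1 \<longleftrightarrow> (norm u)\<^sup>2 = 1"
    unfolding cdot_self using of_real_eq_1_iff by blast
  then show ?thesis
    by (simp add: power2_eq_1_iff) (metis norm_ge_zero not_one_le_zero neg_0_le_iff_le)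
qed

lemma cdot_matrix_vector: "cdot u (A *v w) = cdot (cadjoint A *v u) w"
proof -
  have "cdot u (A *v w) = (\<Sum>i\<in>UNIV. \<Sum>j\<in>UNIV. cnj (u $ i) * (A $ i $ j * w $ j))"
    by (simp add: cdot_def matrix_vector_mult_def sum_distrib_left)
  also have "\<dots> = (\<Sum>j\<in>UNIV. \<Sum>i\<in>UNIV. cnj (u $ i) * (A $ i $ j * w $ j))"
    by (rule sum.swap)
  also have "\<dots> = cdot (cadjoint A *v u) w"
    by (simp add: cdot_def matrix_vector_mult_def cadjoint_def transpose_def
        sum_distrib_left sum_distrib_right algebra_simps)
  finally show ?thesis .
qed

lemma matrix_vector_mult_scaleR_complex:
  fixes A :: "complex^'n^'m"
  shows "A *v (c *\<^sub>R w) = c *\<^sub>R (A *v w)"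
  by (simp add: matrix_vector_mult_def vec_eq_iff scaleR_sum_right)

lemma cadjoint_cadjoint: "cadjoint (cadjoint A) = A"
  by (simp add: cadjoint_def transpose_def vec_eq_iff)

lemma continuous_on_cdot [continuous_intros]:
  assumes "continuous_on S f" "continuous_on S g"
  shows "continuous_on S (\<lambda>x. cdot (f x) (g x))"
  unfolding cdot_def by (intro continuous_intros assms)

lemma continuous_on_matrix_vector [continuous_intros]:
  fixes A :: "complex^'n^'m"
  assumes "continuous_on S f"
  shows "continuous_on S (\<lambda>x. A *v f x)"
  unfolding matrix_vector_mult_def by (intro continuous_intros assms)

section \<open>Quadratic forms and Hermitian matrices\<close>

lemma quad_form_add: "quad_form (A + B) u = quad_form A u + quad_form B u"
  by (simp add: quad_form_def matrix_vector_mult_add_rdistrib cdot_add_right)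

lemma quad_form_diff: "quad_form (A - B) u = quad_form A u - quad_form B u"
  by (simp add: quad_form_def matrix_vector_mult_diff_rdistrib cdot_diff_right)

lemma quad_form_scaleR: "quad_form (c *\<^sub>R A) u = c * quad_form A u"
proof -
  have "(c *\<^sub>R A) *v u = c *\<^sub>R (A *v u)"
    by (simp add: matrix_vector_mult_def vec_eq_iff scaleR_sum_right)
  then show ?thesis
    by (simp add: quad_form_def cdot_scaleR_right)
qed

lemma quad_form_sum: "quad_form (\<Sum>k\<in>S. f k) u = (\<Sum>k\<in>S. quad_form (f k) u)"
  by (induction S rule: infinite_finite_induct)
    (auto simp: quad_form_add, auto simp: quad_form_def cdot_def)

lemma quad_form_rank_one: "quad_form (rank_one x) u = (cmod (cdot x u))\<^sup>2"
proof -
  have "rank_one x *v u = cdot x u *s x"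
    by (simp add: rank_one_def matrix_vector_mult_def cdot_def vec_eq_iff sum_distrib_left
        sum_distrib_right algebra_simps)
  then have "cdot u (rank_one x *v u) = cdot x u * cdot u x"
    by (simp add: cdot_def[of u] sum_distrib_left algebra_simps)
  also have "\<dots> = of_real ((cmod (cdot x u))\<^sup>2)"
    by (metis cnj_cdot complex_norm_square)
  finally show ?thesis
    by (simp add: quad_form_def)
qed

text \<open>This identity moves a Kraus operator from the matrix to the vector; through it every
  expectation under \<open>\<Phi>\<close> or \<open>\<Psi>\<close> becomes an expectation of the input matrix.\<close>

lemma quad_form_congruence: "quad_form (cadjoint W ** A ** W) u = quad_form A (W *v u)"
  by (simp add: quad_form_def matrix_vector_mul_assoc[symmetric] cdot_matrix_vector cadjoint_cadjoint)

lemma quad_form_spectral: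
  "quad_form (\<Sum>k\<in>S. d k *\<^sub>R rank_one (x k)) u = (\<Sum>k\<in>S. d k * (cmod (cdot (x k) u))\<^sup>2)"
  by (simp add: quad_form_sum quad_form_scaleR quad_form_rank_one)

lemma hermitian_rank_one: "hermitian (rank_one x)"
  by (simp add: hermitian_def cadjoint_def rank_one_def transpose_def vec_eq_iff mult.commute)

lemma cadjoint_add: "cadjoint (A + B) = cadjoint A + cadjoint B"
  by (simp add: cadjoint_def transpose_def vec_eq_iff)

lemma hermitian_scaleR: "hermitian A \<Longrightarrow> hermitian (c *\<^sub>R A)"
  by (simp add: hermitian_def cadjoint_def transpose_def vec_eq_iff)

lemma hermitian_add: "hermitian A \<Longrightarrow> hermitian B \<Longrightarrow> hermitian (A + B)"
  by (simp add: hermitian_def cadjoint_add)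

lemma hermitian_diff: "hermitian A \<Longrightarrow> hermitian B \<Longrightarrow> hermitian (A - B)"
  by (simp add: hermitian_def cadjoint_def transpose_def vec_eq_iff)

lemma hermitian_sum: "(\<And>k. k \<in> S \<Longrightarrow> hermitian (f k)) \<Longrightarrow> hermitian (\<Sum>k\<in>S. f k)"
  by (induction S rule: infinite_finite_induct)
    (auto intro: hermitian_add simp: hermitian_def[of 0] cadjoint_def transpose_def vec_eq_iff)

lemma cadjoint_mult: "cadjoint (A ** B) = cadjoint B ** cadjoint A"
  by (simp add: cadjoint_def transpose_def matrix_matrix_mult_def vec_eq_iff mult.commute)

lemma hermitian_congruence: "hermitian A \<Longrightarrow> hermitian (cadjoint W ** A ** W)"
  by (simp add: hermitian_def cadjoint_mult cadjoint_cadjoint matrix_mul_assoc)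

section \<open>Unitary matrices and the spectral theorem\<close>

text \<open>Rows of a unitary matrix are orthonormal by definition; its columns are so because a right
  inverse of a square matrix is a left inverse.\<close>

lemma unitary_columns:
  fixes X :: "complex^'n^'n"
  assumes "X \<in> unitary_matrices"
  shows "cdot (column i X) (column j X) = (if i = j then 1 else 0)"
proof -
  have "cadjoint X ** X = mat 1"
    using assms by (simp add: unitary_matrices_def matrix_left_right_inverse)
  then have "(cadjoint X ** X) $ i $ j = (mat 1 :: complex^'n^'n) $ i $ j"
    by simp
  then show ?thesis
    by (simp add: cadjoint_def transpose_def matrix_matrix_mult_def mat_def cdot_def column_def)
qed

lemma unitary_matrix_of_orthonormal:
  fixes f :: "'n::finite \<Rightarrow> complex^'n"
  assumes "\<And>i j. cdot (f i) (f j) = (if i = j then 1 else 0)"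
  shows "(\<chi> i j. f j $ i) \<in> unitary_matrices"
proof -
  define X where "X = (\<chi> i j. f j $ i)"
  have "cadjoint X ** X = mat 1"
    using assms
    by (simp add: X_def cadjoint_def transpose_def matrix_matrix_mult_def mat_def cdot_def vec_eq_iff)
  then show ?thesis
    by (simp add: unitary_matrices_def matrix_left_right_inverse X_def)
qed

text \<open>The numbers \<open>cdot (column k X) u\<close> are the entries of \<open>cadjoint X *v u\<close>, and \<open>cadjoint X\<close> preserves
  the norm.\<close>

lemma unitary_parseval:
  assumes "X \<in> unitary_matrices"
  shows "(\<Sum>k\<in>UNIV. (cmod (cdot (column k X) u))\<^sup>2) = (norm u)\<^sup>2"
proof -
  have c: "(cadjoint X *v u) $ k = cdot (column k X) u" for k
    by (simp add: cadjoint_def transpose_def matrix_vector_mult_def cdot_def column_def)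
  have "cdot (cadjoint X *v u) (cadjoint X *v u) = cdot u u"
    using assms by (simp add: cdot_matrix_vector[symmetric] cadjoint_cadjoint
        matrix_vector_mul_assoc unitary_matrices_def
        flip: cdot_matrix_vector[of _ "cadjoint X", unfolded cadjoint_cadjoint])
  then have "cdot (cadjoint X *v u) (cadjoint X *v u) = of_real ((norm u)\<^sup>2)"
    by (simp add: cdot_self)
  moreover have "cdot (cadjoint X *v u) (cadjoint X *v u)
      = of_real (\<Sum>k\<in>UNIV. (cmod (cdot (column k X) u))\<^sup>2)"
    unfolding cdot_def[of "cadjoint X *v u"] c of_real_sum
    by (intro sum.cong refl) (metis complex_norm_square mult.commute)
  ultimately show ?thesis
    by (metis of_real_eq_iff)
qed

lemma spectral_sum_eq_product:
  fixes X :: "complex^'n^'n"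
  shows "(\<Sum>k\<in>UNIV. d k *\<^sub>R rank_one (column k X))
    = X ** (\<chi> i j. if i = j then of_real (d i) else 0) ** cadjoint X"
  by (simp add: vec_eq_iff matrix_matrix_mult_def if_distrib[of "(*) _"] cadjoint_def
      transpose_def rank_one_def column_def scaleR_conv_of_real[where 'a=complex] algebra_simps
      cong: if_cong)

lemma unitary_decomposition:
  fixes A X :: "complex^'n^'n"
  assumes X: "X \<in> unitary_matrices"
    and ev: "\<And>k. A *v column k X = of_real (d k) *s column k X"
  shows "A = (\<Sum>k\<in>UNIV. d k *\<^sub>R rank_one (column k X))"
proof -
  define D :: "complex^'n^'n" where "D = (\<chi> i j. if i = j then of_real (d i) else 0)"
  have AX: "A ** X = X ** D"
  proof -
    have "(A ** X) $ i $ k = (X ** D) $ i $ k" for i k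
    proof -
      have "(A ** X) $ i $ k = (A *v column k X) $ i"
        by (simp add: matrix_matrix_mult_def matrix_vector_mult_def column_def)
      also have "\<dots> = (X ** D) $ i $ k"
        unfolding ev
        by (simp add: matrix_matrix_mult_def column_def D_def if_distrib[of "(*) _"]
            cong: if_cong)
      finally show ?thesis .
    qed
    then show ?thesis by (simp add: vec_eq_iff)
  qed
  have "A = A ** (X ** cadjoint X)"
    using X by (simp add: unitary_matrices_def)
  also have "\<dots> = X ** D ** cadjoint X"
    by (simp add: matrix_mul_assoc AX)
  also have "\<dots> = (\<Sum>k\<in>UNIV. d k *\<^sub>R rank_one (column k X))"
    by (simp add: D_def spectral_sum_eq_product)
  finally show ?thesis .
qed

text \<open>Fewer than \<open>n\<close> linear conditions on \<open>n\<close> unknowns have a nonzero solution: written as a square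
  system with a zero row, they have a matrix without right inverse, so with a nontrivial kernel.\<close>

lemma exists_nonzero_orthogonal:
  fixes f :: "'n::finite \<Rightarrow> complex^'n"
  assumes "k \<notin> T"
  obtains x where "x \<noteq> 0" "\<And>i. i \<in> T \<Longrightarrow> cdot (f i) x = 0"
proof -
  define M :: "complex^'n^'n" where "M = (\<chi> i j. if i \<in> T then cnj (f i $ j) else 0)"
  have "\<not> (\<exists>B. B ** M = mat 1)"
  proof
    assume "\<exists>B. B ** M = mat 1"
    then obtain B where "M ** B = mat 1"
      by (auto simp: matrix_left_right_inverse)
    moreover have "(M ** B) $ k $ k = 0"
      using assms by (simp add: M_def matrix_matrix_mult_def)
    ultimately show False
      by (simp add: mat_def)
  qed
  then obtain x where x: "x \<noteq> 0" "M *v x = 0"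
    unfolding matrix_left_invertible_ker by blast
  have "cdot (f i) x = 0" if "i \<in> T" for i
  proof -
    have "cdot (f i) x = (M *v x) $ i"
      using that by (simp add: M_def matrix_vector_mult_def cdot_def)
    then show ?thesis by (simp add: x)
  qed
  with x(1) show ?thesis by (rule that)
qed

text \<open>Rayleigh's principle. The orthogonal complement \<open>W\<close> of the given eigenvectors is invariant under
  \<open>A\<close>, and the quadratic form of \<open>A\<close> attains a maximum \<open>c\<close> on the unit sphere of \<open>W\<close>, at \<open>x\<close> say. Then
  \<open>x\<close> is an eigenvector: otherwise the residual \<open>y = A x - c x\<close>, which also lies in \<open>W\<close>, would be a
  direction along which the Rayleigh quotient increases.\<close>

lemma orthogonal_eigenvector:
  fixes A :: "complex^'n^'n" and f :: "'n \<Rightarrow> complex^'n"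
  assumes A: "hermitian A" and k: "k \<notin> T"
    and ev: "\<And>i. i \<in> T \<Longrightarrow> A *v f i = of_real (d i) *s f i"
  obtains x c where "norm x = 1" "\<And>i. i \<in> T \<Longrightarrow> cdot (f i) x = 0" "A *v x = of_real c *s x"
proof -
  define W where "W = {x. \<forall>i\<in>T. cdot (f i) x = 0}"
  define K where "K = sphere 0 1 \<inter> W"
  have W_scale: "c *\<^sub>R x \<in> W" if "x \<in> W" for c x
    using that by (simp add: W_def cdot_scaleR_right)
  have W_add: "x + y \<in> W" if "x \<in> W" "y \<in> W" for x y
    using that by (simp add: W_def cdot_add_right)
  have W_diff: "x - y \<in> W" if "x \<in> W" "y \<in> W" for x y
    using that by (simp add: W_def cdot_diff_right)
  have W_A: "A *v x \<in> W" if "x \<in> W" for x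
  proof -
    have "cdot (f i) (A *v x) = 0" if i: "i \<in> T" for i
    proof -
      have "cdot (f i) (A *v x) = cdot (of_real (d i) *s f i) x"
        using A by (simp add: cdot_matrix_vector hermitian_def ev i)
      also have "\<dots> = of_real (d i) * cdot (f i) x"
        by (simp add: cdot_def sum_distrib_left algebra_simps)
      finally show ?thesis using \<open>x \<in> W\<close> i by (simp add: W_def)
    qed
    then show ?thesis by (simp add: W_def)
  qed
  have "closed W"
  proof -
    have "W = (\<Inter>i\<in>T. {x. cdot (f i) x = 0})"
      by (auto simp: W_def)
    moreover have "closed {x. cdot (f i) x = 0}" for i
      by (intro closed_Collect_eq continuous_intros)
    ultimately show ?thesis by auto
  qed
  then have "compact K"
    unfolding K_def by (intro compact_Int_closed) auto
  moreover have "K \<noteq> {}"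
  proof -
    obtain x where x: "x \<noteq> 0" "\<And>i. i \<in> T \<Longrightarrow> cdot (f i) x = 0"
      using exists_nonzero_orthogonal[OF k] by blast
    then have "(1 / norm x) *\<^sub>R x \<in> K"
      using W_scale[of x] by (simp add: K_def W_def)
    then show ?thesis by blast
  qed
  moreover have "continuous_on K (quad_form A)"
    unfolding quad_form_def by (intro continuous_intros)
  ultimately have "\<exists>x\<in>K. \<forall>y\<in>K. quad_form A y \<le> quad_form A x"
    by (rule continuous_attains_sup)
  then obtain x where x: "x \<in> K" and max: "\<And>y. y \<in> K \<Longrightarrow> quad_form A y \<le> quad_form A x"
    by blast
  define c where "c = quad_form A x"
  have nx: "norm x = 1" and xW: "x \<in> W"
    using x by (auto simp: K_def)
  have quad_scale: "quad_form A (r *\<^sub>R w) = r\<^sup>2 * quad_form A w" for r w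
    by (simp add: quad_form_def matrix_vector_mult_scaleR_complex cdot_scaleR_right cdot_scaleR_left
        power2_eq_square)
  have bound: "quad_form A w \<le> c * (norm w)\<^sup>2" if "w \<in> W" for w
  proof (cases "w = 0")
    case True
    then show ?thesis by (simp add: quad_form_def cdot_def)
  next
    case False
    then have "(1 / norm w) *\<^sub>R w \<in> K"
      using W_scale[OF that] by (simp add: K_def)
    from max[OF this] have "(1 / norm w)\<^sup>2 * quad_form A w \<le> c"
      by (simp only: quad_scale c_def)
    then show ?thesis
      using False by (simp add: field_simps power2_eq_square)
  qed
  define y where "y = A *v x - c *\<^sub>R x"
  have yW: "y \<in> W"
    unfolding y_def by (intro W_diff W_A W_scale xW)
  define C where "C = c * (norm y)\<^sup>2 - quad_form A y"
  \<comment> \<open>Compare the form at \<open>x + t y\<close> with its bound \<open>c (norm (x + t y))\<^sup>2\<close>: the constant terms agree,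
    so the first-order term has to be dominated by the second-order one.\<close>
  have main: "2 * t * (norm y)\<^sup>2 \<le> t\<^sup>2 * C" for t
  proof -
    have Re_swap: "Re (cdot v w) = Re (cdot w v)" for v w :: "complex^'n"
      using arg_cong[OF cnj_cdot[of w v], of Re] by simp
    have xy: "Re (cdot x (A *v y)) = Re (cdot y (A *v x))"
      using A Re_swap[of "A *v x" y] by (simp add: cdot_matrix_vector[of x] hermitian_def)
    have lhs: "quad_form A (x + t *\<^sub>R y) = c + 2 * t * Re (cdot y (A *v x)) + t\<^sup>2 * quad_form A y"
      using xy by (simp add: quad_form_def c_def matrix_vector_right_distrib
          matrix_vector_mult_scaleR_complex cdot_add_right cdot_add_left cdot_scaleR_right
          cdot_scaleR_left algebra_simps power2_eq_square)
    have rhs: "(norm (x + t *\<^sub>R y))\<^sup>2 = 1 + 2 * t * Re (cdot y x) + t\<^sup>2 * (norm y)\<^sup>2"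
    proof -
      have n: "(norm w)\<^sup>2 = Re (cdot w w)" for w :: "complex^'n"
        by (simp add: cdot_self)
      have "Re (cdot x x) = 1"
        by (simp add: cdot_self nx)
      then show ?thesis
        unfolding n using Re_swap[of x y]
        by (simp add: cdot_add_right cdot_add_left cdot_scaleR_right
          cdot_scaleR_left algebra_simps power2_eq_square)
    qed
    have "quad_form A (x + t *\<^sub>R y) \<le> c * (norm (x + t *\<^sub>R y))\<^sup>2"
      by (intro bound W_add W_scale xW yW)
    then have "2 * t * (Re (cdot y (A *v x)) - c * Re (cdot y x)) \<le> t\<^sup>2 * C"
      unfolding lhs rhs C_def by (simp add: algebra_simps)
    moreover have "(norm y)\<^sup>2 = Re (cdot y (A *v x)) - c * Re (cdot y x)"
    proof -
      have "(norm y)\<^sup>2 = Re (cdot y y)"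
        by (simp add: cdot_self)
      also have "cdot y y = cdot y (A *v x) - of_real c * cdot y x"
        by (subst (2) y_def) (simp add: cdot_diff_right cdot_scaleR_right)
      finally show ?thesis by simp
    qed
    ultimately show ?thesis
      by simp
  qed
  have "(norm y)\<^sup>2 \<le> 0"
  proof (rule ccontr)
    assume "\<not> (norm y)\<^sup>2 \<le> 0"
    \<comment> \<open>A step so short that, after division by \<open>t\<close>, the second-order term is at most half of
      the first-order one.\<close>
    define t where "t = (norm y)\<^sup>2 / (\<bar>C\<bar> + 1)"
    have t: "t > 0"
      using \<open>\<not> (norm y)\<^sup>2 \<le> 0\<close> by (simp add: t_def)
    have "2 * t * (norm y)\<^sup>2 \<le> t * (t * C)"
      using main[of t] by (simp add: power2_eq_square algebra_simps)
    then have "2 * (norm y)\<^sup>2 \<le> t * C"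
      using t by (simp add: mult.assoc mult.left_commute)
    also have "\<dots> \<le> t * (\<bar>C\<bar> + 1)"
      using t by (intro mult_left_mono) auto
    also have "\<dots> = (norm y)\<^sup>2"
      by (simp add: t_def add_pos_nonneg field_simps)
    finally show False
      using \<open>\<not> (norm y)\<^sup>2 \<le> 0\<close> by simp
  qed
  then have "A *v x = of_real c *s x"
    by (simp add: y_def vec_eq_iff scaleR_conv_of_real[where 'a=complex])
  with nx xW show ?thesis
    by (intro that) (auto simp: W_def)
qed

text \<open>The orthonormal eigenvectors are found one index at a time, each orthogonal to the previous ones.\<close>

theorem hermitian_spectral_decomposition:
  fixes A :: "complex^'n^'n"
  assumes A: "hermitian A"
  obtains X d where "X \<in> unitary_matrices" "A = (\<Sum>k\<in>UNIV. d k *\<^sub>R rank_one (column k X))"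
proof -
  have "\<exists>f d. (\<forall>i\<in>T. A *v f i = of_real (d i) *s f i) \<and>
      (\<forall>i\<in>T. \<forall>j\<in>T. cdot (f i) (f j) = (if i = j then 1 else 0))" for T :: "'n set"
  proof (induction T rule: finite_induct[OF finite])
    case 1
    then show ?case by simp
  next
    case (2 k T)
    then obtain f d where ev: "\<And>i. i \<in> T \<Longrightarrow> A *v f i = of_real (d i) *s f i"
      and on: "\<And>i j. i \<in> T \<Longrightarrow> j \<in> T \<Longrightarrow> cdot (f i) (f j) = (if i = j then 1 else 0)"
      by blast
    obtain x c where x: "norm x = 1" "\<And>i. i \<in> T \<Longrightarrow> cdot (f i) x = 0" "A *v x = of_real c *s x"
      using orthogonal_eigenvector[OF A \<open>k \<notin> T\<close>, of f d] ev by blast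
    have x': "cdot x (f i) = 0" if "i \<in> T" for i
      by (metis cnj_cdot complex_cnj_zero that x(2))
    have "cdot x x = 1"
      by (simp add: cdot_self x(1))
    with ev on x x' \<open>k \<notin> T\<close> show ?case
      by (intro exI[of _ "f(k := x)"] exI[of _ "d(k := c)"]) auto
  qed
  from this[of UNIV] obtain f :: "'n \<Rightarrow> complex^'n" and d :: "'n \<Rightarrow> real"
    where fd: "\<forall>i\<in>UNIV. A *v f i = of_real (d i) *s f i"
      "\<forall>i\<in>UNIV. \<forall>j\<in>UNIV. cdot (f i) (f j) = (if i = j then 1 else 0)"
    by blast
  then have ev: "A *v f i = of_real (d i) *s f i"
    and on: "cdot (f i) (f j) = (if i = j then 1 else 0)" for i j
    by blast+
  define X :: "complex^'n^'n" where "X = (\<chi> i j. f j $ i)"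
  have "column k X = f k" for k
    by (simp add: column_def X_def vec_eq_iff)
  moreover have "X \<in> unitary_matrices"
    unfolding X_def by (rule unitary_matrix_of_orthonormal[OF on])
  ultimately show ?thesis
    by (intro that[of X d] unitary_decomposition) (simp_all add: ev)
qed

text \<open>This links the definition of eigenvalues as roots of the characteristic polynomial, with
  multiplicity, to the spectral decomposition: conjugation by the unitary matrix, read as a matrix
  of constant polynomials, turns \<open>x I - A\<close> into a diagonal matrix.\<close>

lemma eigenvalues_spectral:
  fixes d :: "'n::finite \<Rightarrow> real"
  assumes X: "X \<in> unitary_matrices"
    and A: "A = (\<Sum>k\<in>UNIV. d k *\<^sub>R rank_one (column k X))"
  shows "eigenvalues A = image_mset (\<lambda>k. of_real (d k)) (mset_set UNIV)"
proof -
  define D :: "complex^'n^'n" where "D = (\<chi> i j. if i = j then of_real (d i) else 0)"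
  \<comment> \<open>\<open>L\<close> reads a matrix as one of constant polynomials; it is a ring homomorphism.\<close>
  define L :: "complex^'n^'n \<Rightarrow> complex poly^'n^'n" where "L = map_matrix (\<lambda>a. [:a:])"
  have L_mult: "L (P ** Q) = L P ** L Q" for P Q
  proof -
    have "[:\<Sum>k\<in>S. f k:] = (\<Sum>k\<in>S. [:f k:])" for S and f :: "'n \<Rightarrow> complex"
    proof -
      have "[:a + b:] = [:a:] + [:b:]" for a b :: complex
        by simp
      then show ?thesis
        by (induction S rule: infinite_finite_induct) (simp_all del: add_pCons)
    qed
    then show ?thesis
      by (simp add: L_def vec_eq_iff matrix_matrix_mult_def mult.commute[of "P $ _ $ _"])
  qed
  have L_1: "L (mat 1) = mat 1"
    by (simp add: L_def vec_eq_iff mat_def)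
  have A': "A = X ** D ** cadjoint X"
    by (simp add: A D_def spectral_sum_eq_product)
  have "cadjoint X ** X = mat 1"
    using X by (simp add: unitary_matrices_def matrix_left_right_inverse)
  then have AX: "A ** X = X ** D"
    by (simp add: A' matrix_mul_assoc[symmetric])
  have comm: "mat p ** P = P ** mat p" for p and P :: "complex poly^'n^'n"
    by (simp add: vec_eq_iff matrix_matrix_mult_def mat_def if_distrib[of "(*) _"]
        if_distrib[of "\<lambda>x. x * _"] mult.commute[of p] cong: if_cong)
  have diffl: "P ** (Q - R) = P ** Q - P ** R" and diffr: "(Q - R) ** P = Q ** P - R ** P"
    for P Q R :: "complex poly^'n^'n"
    by (simp_all add: vec_eq_iff matrix_matrix_mult_def sum_subtractf algebra_simps)
  have "(mat [:0, 1:] - L A) ** L X = L X ** (mat [:0, 1:] - L D)"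
    by (simp only: diffl diffr comm[of _ "L X"] L_mult[symmetric] AX)
  then have "det (mat [:0, 1:] - L A) * det (L X) = det (mat [:0, 1:] - L D) * det (L X)"
    by (metis det_mul mult.commute)
  moreover have "det (L X) \<noteq> 0"
  proof
    assume "det (L X) = 0"
    then have "det (L X ** L (cadjoint X)) = 0"
      by (simp add: det_mul)
    then show False
      using X by (simp add: L_mult[symmetric] unitary_matrices_def L_1)
  qed
  ultimately have "charpoly A = det (mat [:0, 1:] - L D)"
    by (simp add: charpoly_def L_def)
  also have "\<dots> = (\<Prod>k\<in>UNIV. [:- of_real (d k), 1:])"
    by (subst det_diagonal) (auto simp: L_def mat_def D_def)
  finally have "eigenvalues A = proots (\<Prod>k\<in>UNIV. [:- of_real (d k), 1:])"
    by (simp add: eigenvalues_def)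
  also have "\<dots> = (\<Sum>k\<in>(UNIV::'n set). {#of_real (d k)#})"
    by (subst proots_prod) auto
  also have "\<dots> = image_mset (\<lambda>k. of_real (d k)) (mset_set UNIV)"
  proof -
    have "(\<Sum>k\<in>S. {#of_real (d k) :: complex#}) = image_mset (\<lambda>k. of_real (d k)) (mset_set S)"
      if "finite S" for S
      using that by (induction S rule: finite_induct) auto
    then show ?thesis by simp
  qed
  finally show ?thesis .
qed

section \<open>Extreme eigenvalues and the trace norm\<close>

lemma trace_norm_spectral:
  fixes d :: "'n::finite \<Rightarrow> real"
  assumes "X \<in> unitary_matrices" "A = (\<Sum>k\<in>UNIV. d k *\<^sub>R rank_one (column k X))"
  shows "trace_norm A = (\<Sum>k\<in>UNIV. \<bar>d k\<bar>)"
  by (simp add: trace_norm_def eigenvalues_spectral[OF assms] sum_unfold_sum_mset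
      multiset.map_comp comp_def)

lemma lambda_max_spectral:
  fixes d :: "'n::finite \<Rightarrow> real"
  assumes "X \<in> unitary_matrices" "A = (\<Sum>k\<in>UNIV. d k *\<^sub>R rank_one (column k X))"
  shows "lambda_max A = Max (range d)"
  by (simp add: lambda_max_def eigenvalues_spectral[OF assms] image_image)

lemma lambda_min_spectral:
  fixes d :: "'n::finite \<Rightarrow> real"
  assumes "X \<in> unitary_matrices" "A = (\<Sum>k\<in>UNIV. d k *\<^sub>R rank_one (column k X))"
  shows "lambda_min A = Min (range d)"
  by (simp add: lambda_min_def eigenvalues_spectral[OF assms] image_image)

lemma trace_rank_one: "trace (rank_one x) = cdot x x"
  by (simp add: trace_def rank_one_def cdot_def mult.commute)

lemma trace_spectral:
  assumes "X \<in> unitary_matrices"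
  shows "trace (\<Sum>k\<in>UNIV. d k *\<^sub>R rank_one (column k X)) = of_real (\<Sum>k\<in>UNIV. d k)"
proof -
  have "trace (\<Sum>k\<in>S. d k *\<^sub>R rank_one (column k X)) = (\<Sum>k\<in>S. of_real (d k) * trace (rank_one (column k X)))" for S
    by (simp add: trace_def sum_distrib_left scaleR_conv_of_real[where 'a=complex]
        sum.swap[of _ S])
  then show ?thesis
    using assms by (simp add: trace_rank_one unitary_columns)
qed

lemma quad_form_spectral_column:
  assumes "X \<in> unitary_matrices"
  shows "quad_form (\<Sum>k\<in>UNIV. d k *\<^sub>R rank_one (column k X)) (column i X) = d i"
  using assms by (simp add: quad_form_spectral unitary_columns if_distrib[of "\<lambda>z. _ * (cmod z)\<^sup>2"] cong: if_cong)

lemma norm_unitary_column: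
  assumes "X \<in> unitary_matrices"
  shows "norm (column k X) = 1"
  using unitary_columns[OF assms, of k k] by (simp add: cdot_self_eq_1_iff)

lemma trace_norm_attained:
  fixes B :: "complex^'n^'n"
  assumes "hermitian B"
  obtains X where "X \<in> unitary_matrices" "trace_norm B = (\<Sum>k\<in>UNIV. \<bar>quad_form B (column k X)\<bar>)"
proof -
  obtain X d where X: "X \<in> unitary_matrices" "B = (\<Sum>k\<in>UNIV. d k *\<^sub>R rank_one (column k X))"
    using hermitian_spectral_decomposition[OF assms] by blast
  have "trace_norm B = (\<Sum>k\<in>UNIV. \<bar>quad_form B (column k X)\<bar>)"
    unfolding trace_norm_spectral[OF X] by (simp add: X(2) quad_form_spectral_column[OF X(1)])
  with X(1) show ?thesis by (rule that)
qed

text \<open>Together with \<open>trace_norm_attained\<close> this is the variational formula for the trace norm as the maximum of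
  \<open>\<Sum>k. \<bar>x\<^sub>k\<^sup>* B x\<^sub>k\<bar>\<close> over orthonormal bases. In an eigenbasis of \<open>B\<close>, the diagonal entries of \<open>B\<close> with
  respect to another basis are averages of the eigenvalues with doubly stochastic weights.\<close>

lemma sum_abs_quad_form_le_trace_norm:
  fixes B :: "complex^'n^'n"
  assumes "hermitian B" and X: "X \<in> unitary_matrices"
  shows "(\<Sum>k\<in>UNIV. \<bar>quad_form B (column k X)\<bar>) \<le> trace_norm B"
proof -
  obtain Y d where Y: "Y \<in> unitary_matrices" "B = (\<Sum>j\<in>UNIV. d j *\<^sub>R rank_one (column j Y))"
    using hermitian_spectral_decomposition[OF assms(1)] by blast
  let ?p = "\<lambda>j k. (cmod (cdot (column j Y) (column k X)))\<^sup>2"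
  have "(\<Sum>k\<in>UNIV. \<bar>quad_form B (column k X)\<bar>) \<le> (\<Sum>k\<in>UNIV. \<Sum>j\<in>UNIV. \<bar>d j\<bar> * ?p j k)"
  proof (rule sum_mono)
    fix k
    have "\<bar>quad_form B (column k X)\<bar> \<le> (\<Sum>j\<in>UNIV. \<bar>d j * ?p j k\<bar>)"
      unfolding Y(2) quad_form_spectral by (rule sum_abs)
    then show "\<bar>quad_form B (column k X)\<bar> \<le> (\<Sum>j\<in>UNIV. \<bar>d j\<bar> * ?p j k)"
      by (simp add: abs_mult)
  qed
  also have "\<dots> = (\<Sum>j\<in>UNIV. \<bar>d j\<bar> * (\<Sum>k\<in>UNIV. ?p j k))"
    by (subst sum.swap) (simp add: sum_distrib_left)
  also have "\<dots> = (\<Sum>j\<in>UNIV. \<bar>d j\<bar>)"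
    by (simp add: cmod_cdot_commute[of "column _ Y"] unitary_parseval[OF X] norm_unitary_column[OF Y(1)])
  finally show ?thesis
    by (simp add: trace_norm_spectral[OF Y])
qed

lemma trace_norm_pos:
  fixes B :: "complex^'n^'n"
  assumes "hermitian B" "B \<noteq> 0"
  shows "0 < trace_norm B"
proof -
  obtain Y d where Y: "Y \<in> unitary_matrices" "B = (\<Sum>j\<in>UNIV. d j *\<^sub>R rank_one (column j Y))"
    using hermitian_spectral_decomposition[OF assms(1)] by blast
  then obtain j where "d j \<noteq> 0"
    using assms(2) by (metis (no_types, lifting) scaleR_zero_left sum.neutral)
  then have "0 < (\<Sum>j\<in>UNIV. \<bar>d j\<bar>)"
    by (intro sum_pos2[of _ j]) auto
  then show ?thesis
    by (simp add: trace_norm_spectral[OF Y])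
qed

text \<open>In an eigenbasis of the difference, each absolute eigenvalue is at most the sum of the two
  expectations, and by Parseval each of those sums to 1.\<close>

lemma trace_norm_rank_one_diff_le:
  assumes "norm u = 1" "norm v = 1"
  shows "trace_norm (rank_one u - rank_one v) \<le> 2"
proof -
  obtain X where X: "X \<in> unitary_matrices" and tn:
    "trace_norm (rank_one u - rank_one v)
      = (\<Sum>k\<in>UNIV. \<bar>quad_form (rank_one u - rank_one v) (column k X)\<bar>)"
    using trace_norm_attained[of "rank_one u - rank_one v"] hermitian_diff hermitian_rank_one
    by metis
  note tn
  also have "\<dots> \<le> (\<Sum>k\<in>UNIV. (cmod (cdot (column k X) u))\<^sup>2 + (cmod (cdot (column k X) v))\<^sup>2)"
    by (intro sum_mono) (simp add: quad_form_diff quad_form_rank_one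
        cmod_cdot_commute[of _ "column _ X"] abs_le_iff add_increasing add_increasing2)
  also have "\<dots> = 2"
    by (simp add: sum.distrib unitary_parseval[OF X] assms)
  finally show ?thesis .
qed

lemma quad_form_eigenvalue_bounds:
  fixes B :: "complex^'n^'n"
  assumes "hermitian B" "norm u = 1"
  shows "lambda_min B \<le> quad_form B u" "quad_form B u \<le> lambda_max B"
proof -
  obtain X d where X: "X \<in> unitary_matrices" "B = (\<Sum>k\<in>UNIV. d k *\<^sub>R rank_one (column k X))"
    using hermitian_spectral_decomposition[OF assms(1)] by blast
  let ?p = "\<lambda>k. (cmod (cdot (column k X) u))\<^sup>2"
  have p: "sum ?p UNIV = 1"
    by (simp add: unitary_parseval[OF X(1)] assms)
  have q: "quad_form B u = (\<Sum>k\<in>UNIV. d k * ?p k)"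
    by (simp add: X(2) quad_form_spectral)
  have "lambda_min B * sum ?p UNIV \<le> quad_form B u"
    unfolding q sum_distrib_left lambda_min_spectral[OF X]
    by (intro sum_mono mult_right_mono) auto
  then show "lambda_min B \<le> quad_form B u" by (simp only: p mult_1_right)
  have "quad_form B u \<le> lambda_max B * sum ?p UNIV"
    unfolding q sum_distrib_left lambda_max_spectral[OF X]
    by (intro sum_mono mult_right_mono) auto
  then show "quad_form B u \<le> lambda_max B" by (simp only: p mult_1_right)
qed

lemma orthonormal_pairs_iff:
  "(u, v) \<in> orthonormal_pairs \<longleftrightarrow> cdot u v = 0 \<and> norm u = 1 \<and> norm v = 1"
  by (simp add: orthonormal_pairs_def cdot_self_eq_1_iff)

lemma unitary_column_pair:
  assumes "X \<in> unitary_matrices" "i \<noteq> j"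
  shows "(column i X, column j X) \<in> orthonormal_pairs"
  using assms by (simp add: orthonormal_pairs_def unitary_columns)

lemma ex_distinct_index:
  assumes "CARD('n::finite) \<ge> 2"
  shows "\<exists>j::'n. j \<noteq> i"
proof (rule ccontr)
  assume "\<nexists>j. j \<noteq> i"
  then have "(UNIV :: 'n set) = {i}" by auto
  then have "CARD('n) = 1" by (metis card_1_singleton_iff One_nat_def)
  with assms show False by simp
qed

text \<open>Unit eigenvectors for the largest and smallest eigenvalue will do. If the two eigenvalues
  coincide then \<open>B\<close> is scalar, and any other member of the eigenbasis may replace one of them; this is
  where dimension at least 2 is needed.\<close>

lemma diameter_attained:
  fixes B :: "complex^'n^'n"
  assumes card: "CARD('n) \<ge> 2" and "hermitian B"
  obtains u v where "(u, v) \<in> orthonormal_pairs"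
    "lambda_max B - lambda_min B = quad_form B u - quad_form B v"
proof -
  obtain X d where X: "X \<in> unitary_matrices" "B = (\<Sum>k\<in>UNIV. d k *\<^sub>R rank_one (column k X))"
    using hermitian_spectral_decomposition[OF assms(2)] by blast
  have "Max (range d) \<in> range d" "Min (range d) \<in> range d"
    by (auto intro: Max_in Min_in)
  then obtain i j where i: "Max (range d) = d i" and j: "Min (range d) = d j"
    by (metis rangeE)
  have "\<exists>i j. i \<noteq> j \<and> Max (range d) = d i \<and> Min (range d) = d j"
  proof (cases "i = j")
    case False
    with i j show ?thesis by blast
  next
    case True
    obtain l where "l \<noteq> i" using ex_distinct_index[OF card] by blast
    moreover have "d l = d i"
    proof (rule antisym)
      show "d l \<le> d i" unfolding i[symmetric] by simp
      show "d i \<le> d l" unfolding True j[symmetric] by simp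
    qed
    ultimately show ?thesis using i j True by metis
  qed
  then obtain i j where ij: "i \<noteq> j" "Max (range d) = d i" "Min (range d) = d j" by blast
  show ?thesis
  proof (rule that)
    show "(column i X, column j X) \<in> orthonormal_pairs"
      by (rule unitary_column_pair) fact+
    show "lambda_max B - lambda_min B = quad_form B (column i X) - quad_form B (column j X)"
      by (simp add: lambda_max_spectral[OF X] lambda_min_spectral[OF X] ij(2,3))
        (simp add: X(2) quad_form_spectral_column[OF X(1)])
  qed
qed

lemma sum_rank_one_columns:
  assumes "X \<in> unitary_matrices"
  shows "(\<Sum>k\<in>UNIV. rank_one (column k X)) = mat 1"
  using unitary_decomposition[OF assms, of "mat 1" "\<lambda>_. 1"] by simp

lemma diameter_pos:
  fixes B :: "complex^'n^'n"
  assumes "hermitian B" "B \<notin> range (\<lambda>c::real. c *\<^sub>R mat 1)"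
  shows "lambda_min B < lambda_max B"
proof (rule ccontr)
  assume *: "\<not> lambda_min B < lambda_max B"
  obtain X d where X: "X \<in> unitary_matrices" "B = (\<Sum>k\<in>UNIV. d k *\<^sub>R rank_one (column k X))"
    using hermitian_spectral_decomposition[OF assms(1)] by blast
  have "d k = Max (range d)" for k
  proof (rule antisym)
    have "Max (range d) \<le> Min (range d)"
      using * unfolding lambda_max_spectral[OF X] lambda_min_spectral[OF X] by (rule leI)
    also have "\<dots> \<le> d k" by simp
    finally show "Max (range d) \<le> d k" .
  qed simp
  then have "B = (\<Sum>k\<in>UNIV. Max (range d) *\<^sub>R rank_one (column k X))"
    using X(2) by (metis (no_types, lifting) sum.cong)
  also have "\<dots> = Max (range d) *\<^sub>R mat 1"
    by (simp add: scaleR_sum_right[symmetric] sum_rank_one_columns[OF X(1)])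
  finally show False using assms(2) by blast
qed

section \<open>Zero-sum families of real numbers\<close>

text \<open>The positive part of a zero-sum family is half of its absolute sum, so the indices of positive
  terms form the required set. If all terms vanish that set is empty and a singleton replaces it.\<close>

lemma half_abs_sum_on_proper_subset:
  fixes f :: "'n::finite \<Rightarrow> real"
  assumes card: "CARD('n) \<ge> 2" and f: "(\<Sum>k\<in>UNIV. f k) = 0"
  obtains E where "E \<noteq> {}" "E \<noteq> UNIV" "(\<Sum>k\<in>E. f k) = (\<Sum>k\<in>UNIV. \<bar>f k\<bar>) / 2"
proof (cases "\<forall>k. f k = 0")
  case True
  obtain i :: 'n where True by simp
  obtain j where "j \<noteq> i" using ex_distinct_index[OF card] by blast
  show ?thesis
    by (rule that[of "{i}"]) (use True \<open>j \<noteq> i\<close> in auto)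
next
  case False
  define E where "E = {k. f k > 0}"
  have "(\<Sum>k\<in>UNIV. f k + \<bar>f k\<bar>) = (\<Sum>k\<in>UNIV. if k \<in> E then 2 * f k else 0)"
    by (intro sum.cong) (auto simp: E_def)
  then have eq: "(\<Sum>k\<in>UNIV. \<bar>f k\<bar>) = 2 * (\<Sum>k\<in>E. f k)"
    by (simp add: sum.distrib f sum_distrib_left flip: sum.inter_restrict)
  moreover have "E \<noteq> {}"
  proof
    assume "E = {}"
    with eq have "(\<Sum>k\<in>UNIV. \<bar>f k\<bar>) = 0" by simp
    with False show False by (simp add: sum_nonneg_eq_0_iff)
  qed
  moreover have "E \<noteq> UNIV"
  proof
    assume "E = UNIV"
    with eq f have "(\<Sum>k\<in>UNIV. \<bar>f k\<bar>) = 0" by simp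
    with False show False by (simp add: sum_nonneg_eq_0_iff)
  qed
  ultimately show ?thesis
    using that[of E] by simp
qed

text \<open>A zero-sum family \<open>d\<close> is a nonnegative combination of differences of unit point masses: couple its
  positive part \<open>p\<close> and its negative part \<open>q\<close>, both of total mass \<open>t\<close>, by the product weights
  \<open>p i * q j / t\<close>. Hence a bound for differences of two columns of \<open>g\<close> gives a bound for every zero-sum
  combination of the columns.\<close>

lemma balanced_sum_le:
  fixes d :: "'n::finite \<Rightarrow> real" and g :: "'k \<Rightarrow> 'n \<Rightarrow> real"
  assumes d: "(\<Sum>i\<in>UNIV. d i) = 0"
    and C: "\<And>i j. i \<noteq> j \<Longrightarrow> (\<Sum>k\<in>K. \<bar>g k i - g k j\<bar>) \<le> C"
  shows "(\<Sum>k\<in>K. \<bar>\<Sum>i\<in>UNIV. d i * g k i\<bar>) \<le> C / 2 * (\<Sum>i\<in>UNIV. \<bar>d i\<bar>)"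
proof -
  define p where "p i = max (d i) 0" for i
  define q where "q i = max (- d i) 0" for i
  define t where "t = (\<Sum>i\<in>UNIV. p i)"
  have pq: "d i = p i - q i" "\<bar>d i\<bar> = p i + q i" "p i * q i = 0" "p i \<ge> 0" "q i \<ge> 0" for i
    by (auto simp: p_def q_def max_def)
  have tq: "(\<Sum>i\<in>UNIV. q i) = t"
    using d by (simp add: pq(1) sum_subtractf t_def)
  have abs_d: "(\<Sum>i\<in>UNIV. \<bar>d i\<bar>) = 2 * t"
    by (simp add: pq(2) sum.distrib tq) (simp add: t_def)
  have t0: "t \<ge> 0" by (simp add: t_def sum_nonneg pq)
  have transport: "t * (\<Sum>i\<in>UNIV. d i * h i) = (\<Sum>i\<in>UNIV. \<Sum>j\<in>UNIV. p i * q j * (h i - h j))"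
    for h
  proof -
    have "(\<Sum>i\<in>UNIV. \<Sum>j\<in>UNIV. p i * q j * (h i - h j))
      = (\<Sum>i\<in>UNIV. p i * h i) * (\<Sum>j\<in>UNIV. q j) - (\<Sum>i\<in>UNIV. p i) * (\<Sum>j\<in>UNIV. q j * h j)"
      unfolding sum_product sum_subtractf[symmetric]
      by (intro sum.cong refl) (simp add: algebra_simps)
    also have "\<dots> = t * ((\<Sum>i\<in>UNIV. p i * h i) - (\<Sum>j\<in>UNIV. q j * h j))"
      by (simp add: tq algebra_simps) (simp add: t_def)
    also have "\<dots> = t * (\<Sum>i\<in>UNIV. d i * h i)"
      by (simp add: pq(1) left_diff_distrib sum_subtractf)
    finally show ?thesis by simp
  qed
  have "t * (\<Sum>k\<in>K. \<bar>\<Sum>i\<in>UNIV. d i * g k i\<bar>) = (\<Sum>k\<in>K. \<bar>t * (\<Sum>i\<in>UNIV. d i * g k i)\<bar>)"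
    unfolding sum_distrib_left[of t _ K] using t0 by (simp only: abs_mult abs_of_nonneg)
  also have "\<dots> \<le> (\<Sum>k\<in>K. \<Sum>i\<in>UNIV. \<Sum>j\<in>UNIV. p i * q j * \<bar>g k i - g k j\<bar>)"
    unfolding transport
  proof (rule sum_mono)
    fix k
    have "\<bar>\<Sum>i\<in>UNIV. \<Sum>j\<in>UNIV. p i * q j * (g k i - g k j)\<bar>
        \<le> (\<Sum>i\<in>UNIV. \<Sum>j\<in>UNIV. \<bar>p i * q j * (g k i - g k j)\<bar>)"
      by (rule order_trans[OF sum_abs]) (intro sum_mono sum_abs)
    then show "\<bar>\<Sum>i\<in>UNIV. \<Sum>j\<in>UNIV. p i * q j * (g k i - g k j)\<bar>
        \<le> (\<Sum>i\<in>UNIV. \<Sum>j\<in>UNIV. p i * q j * \<bar>g k i - g k j\<bar>)"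
      by (simp add: abs_mult pq)
  qed
  also have "\<dots> = (\<Sum>i\<in>UNIV. \<Sum>j\<in>UNIV. p i * q j * (\<Sum>k\<in>K. \<bar>g k i - g k j\<bar>))"
    by (simp add: sum_distrib_left sum.swap[of _ K])
  also have "\<dots> \<le> (\<Sum>i\<in>UNIV. \<Sum>j\<in>UNIV. p i * q j * C)"
  proof (intro sum_mono)
    fix i j
    show "p i * q j * (\<Sum>k\<in>K. \<bar>g k i - g k j\<bar>) \<le> p i * q j * C"
      by (cases "i = j") (auto simp: pq intro!: mult_left_mono C)
  qed
  also have "\<dots> = t * (t * C)"
    by (simp add: sum_distrib_left[symmetric] sum_distrib_right[symmetric] tq)
      (simp add: t_def)
  finally have main: "t * (\<Sum>k\<in>K. \<bar>\<Sum>i\<in>UNIV. d i * g k i\<bar>) \<le> t * (t * C)" .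
  show ?thesis
  proof (cases "t = 0")
    case True
    with abs_d have "d i = 0" for i by (simp add: sum_nonneg_eq_0_iff)
    then show ?thesis by simp
  next
    case False
    with main t0 have "(\<Sum>k\<in>K. \<bar>\<Sum>i\<in>UNIV. d i * g k i\<bar>) \<le> t * C" by simp
    then show ?thesis by (simp add: abs_d mult.commute)
  qed
qed

text \<open>A zero-sum family does not see a constant shift of \<open>d\<close>, and subtracting the midrange
  makes \<open>\<bar>d k\<bar>\<close> at most half of the range.\<close>

lemma centred_sum_le:
  fixes f d :: "'n::finite \<Rightarrow> real"
  assumes f: "(\<Sum>k\<in>UNIV. f k) = 0"
  shows "(\<Sum>k\<in>UNIV. d k * f k) \<le> (Max (range d) - Min (range d)) * ((\<Sum>k\<in>UNIV. \<bar>f k\<bar>) / 2)"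
proof -
  define M where "M = Max (range d)"
  define N where "N = Min (range d)"
  have "(\<Sum>k\<in>UNIV. d k * f k) = (\<Sum>k\<in>UNIV. (d k - (M + N) / 2) * f k)"
    by (simp only: left_diff_distrib sum_subtractf f mult_zero_right diff_zero
        flip: sum_distrib_left)
  also have "\<dots> \<le> (\<Sum>k\<in>UNIV. (M - N) / 2 * \<bar>f k\<bar>)"
  proof (rule sum_mono)
    fix k
    have "d k \<le> M" "N \<le> d k" by (simp_all add: M_def N_def)
    then have "\<bar>d k - (M + N) / 2\<bar> \<le> (M - N) / 2" by (simp add: abs_le_iff field_simps)
    then have "\<bar>(d k - (M + N) / 2) * f k\<bar> \<le> (M - N) / 2 * \<bar>f k\<bar>"
      unfolding abs_mult by (intro mult_right_mono) auto
    then show "(d k - (M + N) / 2) * f k \<le> (M - N) / 2 * \<bar>f k\<bar>" by linarith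
  qed
  also have "\<dots> = (M - N) * ((\<Sum>k\<in>UNIV. \<bar>f k\<bar>) / 2)"
    by (simp only: times_divide_eq_left times_divide_eq_right flip: sum_distrib_left sum_divide_distrib)
  finally show ?thesis by (simp add: M_def N_def)
qed

section \<open>Compactness of the index sets\<close>

lemma compact_unitary_matrices: "compact (unitary_matrices :: (complex^'n^'n) set)"
proof -
  have "bounded (unitary_matrices :: (complex^'n^'n) set)"
    unfolding bounded_iff
  proof (intro exI ballI)
    fix X :: "complex^'n^'n" assume "X \<in> unitary_matrices"
    then have "(X ** cadjoint X) $ i $ i = 1" for i
      by (simp add: unitary_matrices_def mat_def)
    then have "cdot (X $ i) (X $ i) = 1" for i
      by (simp add: matrix_matrix_mult_def cadjoint_def transpose_def cdot_def mult.commute)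
    then show "norm X \<le> sqrt (real CARD('n))"
      by (simp add: cdot_self_eq_1_iff norm_vec_def L2_set_def)
  qed
  moreover have "closed (unitary_matrices :: (complex^'n^'n) set)"
    unfolding unitary_matrices_def matrix_matrix_mult_def cadjoint_def map_matrix_def transpose_def
    by (intro closed_Collect_eq) (auto intro!: continuous_intros)
  ultimately show ?thesis by (simp add: compact_eq_bounded_closed)
qed

lemma compact_orthonormal_pairs:
  "compact (orthonormal_pairs :: ((complex^'n) \<times> (complex^'n)) set)"
proof -
  have eq: "orthonormal_pairs = (sphere 0 1 \<times> sphere 0 1)
      \<inter> {p :: (complex^'n) \<times> (complex^'n). cdot (fst p) (snd p) = 0}"
    by (auto simp: orthonormal_pairs_iff)
  have "closed {p :: (complex^'n) \<times> (complex^'n). cdot (fst p) (snd p) = 0}"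
    by (intro closed_Collect_eq continuous_intros)
  then show ?thesis
    unfolding eq by (intro compact_Int_closed compact_Times compact_sphere)
qed

lemma unitary_matrices_nonempty: "mat 1 \<in> unitary_matrices"
  by (simp add: unitary_matrices_def cadjoint_def transpose_def mat_def vec_eq_iff
      matrix_matrix_mult_def if_distrib[of cnj] if_distrib[of "(*) _"] cong: if_cong)

lemma orthonormal_pairs_nonempty:
  assumes "CARD('n::finite) \<ge> 2"
  shows "(orthonormal_pairs :: ((complex^'n) \<times> (complex^'n)) set) \<noteq> {}"
  using ex_distinct_index[OF assms] unitary_column_pair[OF unitary_matrices_nonempty] by blast

section \<open>Kraus maps and their transition weights\<close>

text \<open>Only the values of the two maps at Hermitian matrices are prescribed, so every use of a map
  below goes together with the Hermiticity of its argument.\<close>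

locale kraus_family =
  fixes V :: "nat \<Rightarrow> complex^'n^'n" and m :: nat
    and \<Phi> \<Psi> :: "complex^'n^'n \<Rightarrow> complex^'n^'n"
  assumes unital: "(\<Sum>i=1..m. cadjoint (V i) ** V i) = mat 1"
    and Phi: "\<And>X. hermitian X \<Longrightarrow> \<Phi> X = (\<Sum>i=1..m. cadjoint (V i) ** X ** V i)"
    and Psi: "\<And>X. hermitian X \<Longrightarrow> \<Psi> X = (\<Sum>i=1..m. V i ** X ** cadjoint (V i))"
begin

text \<open>The transition probability between \<open>x\<close> and \<open>u\<close>. It is at once the expectation of
  \<open>\<Phi> (rank_one x)\<close> at \<open>u\<close> and that of \<open>\<Psi> (rank_one u)\<close> at \<open>x\<close>; the duality of the two maps enters the
  proof through this symmetry alone.\<close>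

definition weight :: "complex^'n \<Rightarrow> complex^'n \<Rightarrow> real" where
  "weight x u = (\<Sum>i=1..m. (cmod (cdot x (V i *v u)))\<^sup>2)"

text \<open>For orthonormal \<open>u\<close>, \<open>v\<close> and unitary \<open>X\<close>, twice the total variation distance between the probability
  distributions that \<open>u\<close> and \<open>v\<close> induce on the columns of \<open>X\<close>.\<close>

definition gap :: "complex^'n \<Rightarrow> complex^'n \<Rightarrow> complex^'n^'n \<Rightarrow> real" where
  "gap u v X = (\<Sum>k\<in>UNIV. \<bar>weight (column k X) u - weight (column k X) v\<bar>)"

lemma hermitian_Phi: "hermitian A \<Longrightarrow> hermitian (\<Phi> A)"
  by (simp add: Phi hermitian_sum hermitian_congruence)

lemma hermitian_Psi: "hermitian A \<Longrightarrow> hermitian (\<Psi> A)"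
  using hermitian_congruence[of A "cadjoint (V _)"]
  by (simp add: Psi hermitian_sum cadjoint_cadjoint)

lemma quad_form_Phi: "hermitian A \<Longrightarrow> quad_form (\<Phi> A) u = (\<Sum>i=1..m. quad_form A (V i *v u))"
  by (simp add: Phi quad_form_sum quad_form_congruence)

lemma quad_form_Psi:
  "hermitian A \<Longrightarrow> quad_form (\<Psi> A) x = (\<Sum>i=1..m. quad_form A (cadjoint (V i) *v x))"
  using quad_form_congruence[of "cadjoint (V _)" A]
  by (simp add: Psi quad_form_sum cadjoint_cadjoint)

lemma quad_form_Phi_rank_one: "quad_form (\<Phi> (rank_one x)) u = weight x u"
  by (simp add: quad_form_Phi hermitian_rank_one quad_form_rank_one weight_def)

lemma quad_form_Psi_rank_one: "quad_form (\<Psi> (rank_one u)) x = weight x u"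
proof -
  have "cmod (cdot u (cadjoint (V i) *v x)) = cmod (cdot x (V i *v u))" for i
    by (metis cadjoint_cadjoint cdot_matrix_vector cmod_cdot_commute)
  then show ?thesis
    by (simp add: quad_form_Psi hermitian_rank_one quad_form_rank_one weight_def)
qed

lemma hermitian_spectral_sum: "hermitian (\<Sum>k\<in>S. d k *\<^sub>R rank_one (x k))"
  by (intro hermitian_sum hermitian_scaleR hermitian_rank_one)

lemma quad_form_Phi_spectral:
  "quad_form (\<Phi> (\<Sum>k\<in>S. d k *\<^sub>R rank_one (x k))) u = (\<Sum>k\<in>S. d k * weight (x k) u)"
proof -
  have "quad_form (\<Phi> (\<Sum>k\<in>S. d k *\<^sub>R rank_one (x k))) u
      = (\<Sum>k\<in>S. d k * quad_form (\<Phi> (rank_one (x k))) u)"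
    by (simp add: quad_form_Phi hermitian_spectral_sum hermitian_rank_one quad_form_sum
        quad_form_scaleR sum_distrib_left sum.swap[of _ S])
  then show ?thesis by (simp add: quad_form_Phi_rank_one)
qed

lemma quad_form_Psi_spectral:
  "quad_form (\<Psi> (\<Sum>k\<in>S. d k *\<^sub>R rank_one (w k))) x = (\<Sum>k\<in>S. d k * weight x (w k))"
proof -
  have "quad_form (\<Psi> (\<Sum>k\<in>S. d k *\<^sub>R rank_one (w k))) x
      = (\<Sum>k\<in>S. d k * quad_form (\<Psi> (rank_one (w k))) x)"
    by (simp add: quad_form_Psi hermitian_spectral_sum hermitian_rank_one quad_form_sum
        quad_form_scaleR sum_distrib_left sum.swap[of _ S])
  then show ?thesis by (simp add: quad_form_Psi_rank_one)
qed

lemma Psi_diff: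
  assumes "hermitian A" "hermitian B"
  shows "\<Psi> (A - B) = \<Psi> A - \<Psi> B"
proof -
  have "W ** (A - B) ** U = W ** A ** U - W ** B ** U" for W U :: "complex^'n^'n"
    by (simp add: vec_eq_iff matrix_matrix_mult_def sum_subtractf algebra_simps)
  then show ?thesis
    by (simp add: Psi assms hermitian_diff sum_subtractf)
qed

text \<open>The columns of \<open>X\<close> resolve the identity and \<open>\<Phi>\<close> is unital.\<close>

lemma sum_weight:
  assumes "X \<in> unitary_matrices"
  shows "(\<Sum>k\<in>UNIV. weight (column k X) u) = (norm u)\<^sup>2"
proof -
  have "hermitian (mat 1 :: complex^'n^'n)"
    by (auto simp: hermitian_def cadjoint_def transpose_def mat_def vec_eq_iff)
  have "\<Phi> (mat 1) = mat 1"
    using \<open>hermitian (mat 1)\<close> unital by (simp add: Phi)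
  then have "quad_form (\<Phi> (\<Sum>k\<in>UNIV. 1 *\<^sub>R rank_one (column k X))) u = quad_form (mat 1) u"
    by (simp add: sum_rank_one_columns[OF assms])
  then show ?thesis
    by (simp only: quad_form_Phi_spectral) (simp add: quad_form_def cdot_self)
qed

lemma sum_weight_diff:
  assumes "X \<in> unitary_matrices" "(u, v) \<in> orthonormal_pairs"
  shows "(\<Sum>k\<in>UNIV. weight (column k X) u - weight (column k X) v) = 0"
  using assms by (simp add: sum_subtractf sum_weight orthonormal_pairs_iff)

lemma column_overlap_weight:
  "column_overlap \<Phi> u v X = (\<Sum>k\<in>UNIV. min (weight (column k X) u) (weight (column k X) v))"
  by (simp add: column_overlap_def quad_form_Phi_rank_one)

text \<open>The overlap of two probability distributions is the complement of their total variation
  distance.\<close>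

lemma column_overlap_gap:
  assumes "X \<in> unitary_matrices" "(u, v) \<in> orthonormal_pairs"
  shows "column_overlap \<Phi> u v X = 1 - gap u v X / 2"
proof -
  have min_eq: "min a b = (a + b - \<bar>a - b\<bar>) / 2" for a b :: real
    by (simp add: min_def abs_if)
  have "column_overlap \<Phi> u v X = ((\<Sum>k\<in>UNIV. weight (column k X) u)
      + (\<Sum>k\<in>UNIV. weight (column k X) v) - gap u v X) / 2"
    unfolding column_overlap_weight min_eq gap_def
    by (simp add: sum_divide_distrib[symmetric] sum_subtractf sum.distrib)
  then show ?thesis
    using assms by (simp add: sum_weight orthonormal_pairs_iff field_simps)
qed

lemma continuous_on_column_overlap:
  "continuous_on S (\<lambda>(p, X). column_overlap \<Phi> (fst p) (snd p) X)"
  unfolding column_overlap_weight weight_def column_def case_prod_unfold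
  by (intro continuous_intros)

text \<open>Extreme eigenvectors \<open>u\<close>, \<open>v\<close> of \<open>\<Phi> A\<close> and an eigenbasis \<open>X\<close> of \<open>A\<close> express the diameter of
  \<open>\<Phi> A\<close> as the eigenvalues of \<open>A\<close> summed against the zero-sum family of weight differences.\<close>

lemma diameter_Phi_le:
  assumes card: "CARD('n) \<ge> 2" and A: "hermitian A"
    and gap: "\<And>u v X. (u, v) \<in> orthonormal_pairs \<Longrightarrow> X \<in> unitary_matrices \<Longrightarrow> gap u v X / 2 \<le> c"
  shows "lambda_max (\<Phi> A) - lambda_min (\<Phi> A) \<le> c * (lambda_max A - lambda_min A)"
proof -
  obtain u v where uv: "(u, v) \<in> orthonormal_pairs"
    and diam: "lambda_max (\<Phi> A) - lambda_min (\<Phi> A) = quad_form (\<Phi> A) u - quad_form (\<Phi> A) v"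
    using diameter_attained[OF card hermitian_Phi[OF A]] by blast
  obtain X d where X: "X \<in> unitary_matrices" "A = (\<Sum>k\<in>UNIV. d k *\<^sub>R rank_one (column k X))"
    using hermitian_spectral_decomposition[OF A] by blast
  have "quad_form (\<Phi> A) u - quad_form (\<Phi> A) v
      = (\<Sum>k\<in>UNIV. d k * (weight (column k X) u - weight (column k X) v))"
    by (simp add: X(2) quad_form_Phi_spectral sum_subtractf right_diff_distrib)
  also have "\<dots> \<le> (Max (range d) - Min (range d)) * (gap u v X / 2)"
    unfolding gap_def by (intro centred_sum_le sum_weight_diff X uv)
  also have "\<dots> \<le> (Max (range d) - Min (range d)) * c"
  proof (rule mult_left_mono[OF gap[OF uv X(1)]])
    have "Min (range d) \<le> d undefined" "d undefined \<le> Max (range d)" by simp_all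
    then show "0 \<le> Max (range d) - Min (range d)" by linarith
  qed
  finally show ?thesis
    by (simp add: diam lambda_max_spectral[OF X] lambda_min_spectral[OF X] mult.commute)
qed

text \<open>The projection \<open>P\<close> onto the span of the columns to which \<open>u\<close> gives more weight than \<open>v\<close> has spectrum \<open>{0, 1}\<close>, and
  \<open>\<Phi> P\<close> separates \<open>u\<close> from \<open>v\<close> by the whole total variation distance. If the weights
  agree on all columns, the span of any single column serves.\<close>

lemma gap_le_diameter_ratio:
  assumes card: "CARD('n) \<ge> 2" and uv: "(u, v) \<in> orthonormal_pairs" and X: "X \<in> unitary_matrices"
  obtains P where "hermitian P" "P \<notin> range (\<lambda>c::real. c *\<^sub>R mat 1)"
    "gap u v X / 2 \<le> (lambda_max (\<Phi> P) - lambda_min (\<Phi> P)) / (lambda_max P - lambda_min P)"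
proof -
  obtain E where E: "E \<noteq> {}" "E \<noteq> UNIV"
    "(\<Sum>k\<in>E. weight (column k X) u - weight (column k X) v) = gap u v X / 2"
    unfolding gap_def
    using half_abs_sum_on_proper_subset[OF card sum_weight_diff[OF X uv]] by blast
  define d :: "'n \<Rightarrow> real" where "d k = (if k \<in> E then 1 else 0)" for k
  define P where "P = (\<Sum>k\<in>UNIV. d k *\<^sub>R rank_one (column k X))"
  have P: "hermitian P"
    unfolding P_def by (rule hermitian_spectral_sum)
  have "range d = {0, 1}"
    using E(1,2) by (auto simp: d_def image_iff)
  then have diam: "lambda_max P = 1" "lambda_min P = 0"
    by (simp_all add: lambda_max_spectral[OF X P_def] lambda_min_spectral[OF X P_def])
  have "P \<notin> range (\<lambda>c::real. c *\<^sub>R mat 1)"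
  proof
    assume "P \<in> range (\<lambda>c::real. c *\<^sub>R mat 1)"
    then obtain c where "P = c *\<^sub>R mat 1" by blast
    then have "quad_form P (column k X) = c" for k
      by (simp add: quad_form_scaleR) (simp add: quad_form_def cdot_self norm_unitary_column[OF X])
    then have "d k = c" for k
      by (simp add: P_def quad_form_spectral_column[OF X])
    with \<open>range d = {0, 1}\<close> show False by (metis (no_types, lifting) insertCI rangeE zero_neq_one)
  qed
  moreover have "gap u v X / 2 = quad_form (\<Phi> P) u - quad_form (\<Phi> P) v"
    unfolding P_def quad_form_Phi_spectral
    by (simp add: E(3)[symmetric] d_def sum_subtractf if_distrib[of "\<lambda>z. z * _"] sum.If_cases
        cong: if_cong)
  moreover have "quad_form (\<Phi> P) u \<le> lambda_max (\<Phi> P)" "lambda_min (\<Phi> P) \<le> quad_form (\<Phi> P) v"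
    using uv by (auto intro!: quad_form_eigenvalue_bounds hermitian_Phi P simp: orthonormal_pairs_iff)
  ultimately show ?thesis
    using P by (intro that[of P]) (simp_all add: diam)
qed

text \<open>The eigenvalues of a traceless \<open>A\<close> sum to 0, so \<open>A\<close> is a combination of differences of orthogonal
  pure states, and for those the hypothesis bounds the trace norm of the image.\<close>

lemma trace_norm_Psi_le:
  assumes A: "hermitian A" "trace A = 0"
    and gap: "\<And>u v X. (u, v) \<in> orthonormal_pairs \<Longrightarrow> X \<in> unitary_matrices \<Longrightarrow> gap u v X / 2 \<le> c"
  shows "trace_norm (\<Psi> A) \<le> c * trace_norm A"
proof -
  obtain W d where W: "W \<in> unitary_matrices" "A = (\<Sum>k\<in>UNIV. d k *\<^sub>R rank_one (column k W))"
    using hermitian_spectral_decomposition[OF A(1)] by blast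
  obtain X where X: "X \<in> unitary_matrices"
    and tn: "trace_norm (\<Psi> A) = (\<Sum>k\<in>UNIV. \<bar>quad_form (\<Psi> A) (column k X)\<bar>)"
    using trace_norm_attained[OF hermitian_Psi[OF A(1)]] by blast
  have "of_real (\<Sum>k\<in>UNIV. d k) = (0::complex)"
    using A(2) trace_spectral[OF W(1)] W(2) by simp
  then have d: "(\<Sum>k\<in>UNIV. d k) = 0"
    using of_real_eq_0_iff by blast
  have "(\<Sum>k\<in>UNIV. \<bar>\<Sum>i\<in>UNIV. d i * weight (column k X) (column i W)\<bar>)
      \<le> 2 * c / 2 * (\<Sum>i\<in>UNIV. \<bar>d i\<bar>)"
  proof (rule balanced_sum_le[OF d])
    fix i j :: 'n assume "i \<noteq> j"
    from gap[OF unitary_column_pair[OF W(1) this] X]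
    show "(\<Sum>k\<in>UNIV. \<bar>weight (column k X) (column i W) - weight (column k X) (column j W)\<bar>) \<le> 2 * c"
      by (simp add: gap_def)
  qed
  then show ?thesis
    by (simp add: tn trace_norm_spectral[OF W]) (simp add: W(2) quad_form_Psi_spectral)
qed

text \<open>Orthogonal pure states are density matrices whose distance in trace norm is at most 2.\<close>

lemma gap_le_trace_norm_ratio:
  assumes uv: "(u, v) \<in> orthonormal_pairs" and X: "X \<in> unitary_matrices"
  shows "rank_one u \<in> density_matrices" "rank_one v \<in> density_matrices" "rank_one u \<noteq> rank_one v"
    "gap u v X / 2 \<le> trace_norm (\<Psi> (rank_one u) - \<Psi> (rank_one v)) / trace_norm (rank_one u - rank_one v)"
proof -
  show "rank_one u \<in> density_matrices" "rank_one v \<in> density_matrices"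
    using uv by (simp_all add: density_matrices_def hermitian_rank_one quad_form_rank_one
        trace_rank_one orthonormal_pairs_def)
  have nu: "norm u = 1" "norm v = 1" and "cdot u v = 0"
    using uv by (auto simp: orthonormal_pairs_iff)
  have "quad_form (rank_one u) u = 1" "quad_form (rank_one v) u = 0"
    using uv by (simp_all add: quad_form_rank_one cmod_cdot_commute[of v] orthonormal_pairs_def)
  then show ne: "rank_one u \<noteq> rank_one v" by auto
  have herm: "hermitian (rank_one u - rank_one v)" "hermitian (\<Psi> (rank_one u) - \<Psi> (rank_one v))"
    by (intro hermitian_diff hermitian_Psi hermitian_rank_one)+
  have "gap u v X = (\<Sum>k\<in>UNIV. \<bar>quad_form (\<Psi> (rank_one u) - \<Psi> (rank_one v)) (column k X)\<bar>)"
    by (simp add: gap_def quad_form_diff quad_form_Psi_rank_one)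
  also have "\<dots> \<le> trace_norm (\<Psi> (rank_one u) - \<Psi> (rank_one v))"
    by (rule sum_abs_quad_form_le_trace_norm[OF herm(2) X])
  finally have le: "gap u v X \<le> trace_norm (\<Psi> (rank_one u) - \<Psi> (rank_one v))" .
  have "0 \<le> gap u v X" by (simp add: gap_def sum_nonneg)
  with le have "gap u v X / 2 \<le> trace_norm (\<Psi> (rank_one u) - \<Psi> (rank_one v)) / 2"
    by simp
  also have "\<dots> \<le> trace_norm (\<Psi> (rank_one u) - \<Psi> (rank_one v)) / trace_norm (rank_one u - rank_one v)"
    using le \<open>0 \<le> gap u v X\<close> trace_norm_rank_one_diff_le[OF nu] trace_norm_pos[OF herm(1)] ne
    by (intro divide_left_mono) auto
  finally show "gap u v X / 2 \<le> trace_norm (\<Psi> (rank_one u) - \<Psi> (rank_one v)) / trace_norm (rank_one u - rank_one v)" .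
qed

end

section \<open>The contraction ratios\<close>

lemma INF_eq_minimum:
  fixes f :: "'a \<Rightarrow> real"
  assumes "x \<in> S" "\<And>y. y \<in> S \<Longrightarrow> f x \<le> f y"
  shows "(INF y\<in>S. f y) = f x"
  using assms by (intro cInf_eq_minimum) auto

theorem corollary7p1:
  fixes V :: "nat \<Rightarrow> complex^'n^'n" and m :: nat
    and \<Phi> \<Psi> :: "complex^'n^'n \<Rightarrow> complex^'n^'n"
  assumes "CARD('n) \<ge> 2"
    and "(\<Sum>i=1..m. cadjoint (V i) ** V i) = mat 1"
    and "\<And>X. hermitian X \<Longrightarrow> \<Phi> X = (\<Sum>i=1..m. cadjoint (V i) ** X ** V i)"
    and "\<And>X. hermitian X \<Longrightarrow> \<Psi> X = (\<Sum>i=1..m. V i ** X ** cadjoint (V i))"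
  shows "(\<forall>(u, v)\<in>orthonormal_pairs. attains_min_on (column_overlap \<Phi> u v) unitary_matrices)
    \<and> attains_min_on (min_overlap \<Phi>) orthonormal_pairs
    \<and> hopf_norm \<Phi> = hopf_dual_norm \<Psi>
    \<and> hopf_dual_norm \<Psi> = ereal (1 - (INF p\<in>orthonormal_pairs. min_overlap \<Phi> p))"
proof -
  interpret kraus_family V m \<Phi> \<Psi>
    by standard (use assms(2-4) in auto)
  let ?O = "orthonormal_pairs :: ((complex^'n) \<times> (complex^'n)) set"
  let ?U = "unitary_matrices :: (complex^'n^'n) set"
  have inner: "\<exists>X\<in>?U. \<forall>Y\<in>?U. column_overlap \<Phi> u v X \<le> column_overlap \<Phi> u v Y" for u v
  proof -
    have "continuous_on ?U (column_overlap \<Phi> u v)"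
      using continuous_on_compose2[OF continuous_on_column_overlap[of UNIV], of ?U "\<lambda>X. ((u, v), X)"]
      by (simp add: continuous_on_Pair)
    then show ?thesis
      using continuous_attains_inf[OF compact_unitary_matrices] unitary_matrices_nonempty by blast
  qed
  have min_eq: "min_overlap \<Phi> (u, v) = column_overlap \<Phi> u v X"
    if "X \<in> ?U" "\<And>Y. Y \<in> ?U \<Longrightarrow> column_overlap \<Phi> u v X \<le> column_overlap \<Phi> u v Y" for u v X
    unfolding min_overlap_def
    using INF_eq_minimum[of X ?U "column_overlap \<Phi> u v"] that by simp
  have "?O \<times> ?U \<noteq> {}"
    using unitary_matrices_nonempty orthonormal_pairs_nonempty[OF assms(1)] by auto
  then obtain z where z: "z \<in> ?O \<times> ?U" and z_min: "\<And>w. w \<in> ?O \<times> ?U \<Longrightarrow>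
      (case z of (p, X) \<Rightarrow> column_overlap \<Phi> (fst p) (snd p) X)
        \<le> (case w of (p, X) \<Rightarrow> column_overlap \<Phi> (fst p) (snd p) X)"
    using continuous_attains_inf[OF compact_Times[OF compact_orthonormal_pairs compact_unitary_matrices]
        _ continuous_on_column_overlap] by blast
  \<comment> \<open>Minimising over orthonormal pairs and unitary matrices jointly gives the outer minimum as well.\<close>
  obtain a b Z where z_eq: "z = ((a, b), Z)" by (metis prod.collapse)
  have ab: "(a, b) \<in> ?O" and Z: "Z \<in> ?U"
    using z by (auto simp: z_eq)
  have opt: "column_overlap \<Phi> a b Z \<le> column_overlap \<Phi> u v X" if "(u, v) \<in> ?O" "X \<in> ?U" for u v X
    using z_min[of "((u, v), X)"] that by (simp add: z_eq)
  have min_ab: "min_overlap \<Phi> (a, b) = column_overlap \<Phi> a b Z"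
    using min_eq[OF Z opt[OF ab]] .
  have outer: "min_overlap \<Phi> (a, b) \<le> min_overlap \<Phi> p" if "p \<in> ?O" for p
  proof -
    obtain u v where p: "p = (u, v)" by fastforce
    obtain X where "X \<in> ?U" "\<And>Y. Y \<in> ?U \<Longrightarrow> column_overlap \<Phi> u v X \<le> column_overlap \<Phi> u v Y"
      using inner by blast
    then show ?thesis
      using min_eq[of X u v] opt[of u v X] that by (simp add: p min_ab)
  qed
  define c where "c = gap a b Z / 2"
  have min_value: "1 - (INF p\<in>?O. min_overlap \<Phi> p) = c"
    using INF_eq_minimum[of "(a, b)" ?O "min_overlap \<Phi>"] outer ab
    by (simp add: min_ab column_overlap_gap[OF Z ab] c_def)
  have gap_le: "gap u v X / 2 \<le> c" if "(u, v) \<in> ?O" "X \<in> ?U" for u v X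
    using opt[OF that] by (simp add: column_overlap_gap[OF that(2,1)] column_overlap_gap[OF Z ab] c_def)
  have "hopf_norm \<Phi> = ereal c"
    unfolding hopf_norm_def
  proof (rule antisym)
    show "(SUP X\<in>{X. hermitian X} - range (\<lambda>c::real. c *\<^sub>R mat 1).
        ereal ((lambda_max (\<Phi> X) - lambda_min (\<Phi> X)) / (lambda_max X - lambda_min X))) \<le> ereal c"
    proof (rule SUP_least)
      fix X :: "complex^'n^'n" assume X: "X \<in> {X. hermitian X} - range (\<lambda>c::real. c *\<^sub>R mat 1)"
      then show "ereal ((lambda_max (\<Phi> X) - lambda_min (\<Phi> X)) / (lambda_max X - lambda_min X)) \<le> ereal c"
        using diameter_pos[of X] diameter_Phi_le[OF assms(1) _ gap_le, of X]
        by (simp add: pos_divide_le_eq)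
    qed
  next
    obtain P where P: "hermitian P" "P \<notin> range (\<lambda>c::real. c *\<^sub>R mat 1)"
      "c \<le> (lambda_max (\<Phi> P) - lambda_min (\<Phi> P)) / (lambda_max P - lambda_min P)"
      using gap_le_diameter_ratio[OF assms(1) ab Z] unfolding c_def by blast
    show "ereal c \<le> (SUP X\<in>{X. hermitian X} - range (\<lambda>c::real. c *\<^sub>R mat 1).
        ereal ((lambda_max (\<Phi> X) - lambda_min (\<Phi> X)) / (lambda_max X - lambda_min X)))"
      by (rule SUP_upper2[of P]) (use P in auto)
  qed
  moreover have "hopf_dual_norm \<Psi> = ereal c"
    unfolding hopf_dual_norm_def
  proof (rule antisym)
    show "(SUP (\<rho>\<^sub>1, \<rho>\<^sub>2)\<in>{(\<rho>\<^sub>1, \<rho>\<^sub>2). \<rho>\<^sub>1 \<in> density_matrices \<and> \<rho>\<^sub>2 \<in> density_matrices \<and> \<rho>\<^sub>1 \<noteq> \<rho>\<^sub>2}.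
        ereal (trace_norm (\<Psi> \<rho>\<^sub>1 - \<Psi> \<rho>\<^sub>2) / trace_norm (\<rho>\<^sub>1 - \<rho>\<^sub>2))) \<le> ereal c"
    proof (rule SUP_least, clarify)
      fix \<rho> \<sigma> :: "complex^'n^'n"
      assume \<rho>\<sigma>: "\<rho> \<in> density_matrices" "\<sigma> \<in> density_matrices" "\<rho> \<noteq> \<sigma>"
      then have "hermitian \<rho>" "hermitian \<sigma>" "trace (\<rho> - \<sigma>) = 0"
        by (auto simp: density_matrices_def trace_sub)
      then show "ereal (trace_norm (\<Psi> \<rho> - \<Psi> \<sigma>) / trace_norm (\<rho> - \<sigma>)) \<le> ereal c"
        using trace_norm_Psi_le[OF hermitian_diff _ gap_le, of \<rho> \<sigma>]
          trace_norm_pos[OF hermitian_diff, of \<rho> \<sigma>] \<rho>\<sigma>(3)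
        by (simp add: Psi_diff pos_divide_le_eq)
    qed
  next
    show "ereal c \<le> (SUP (\<rho>\<^sub>1, \<rho>\<^sub>2)\<in>{(\<rho>\<^sub>1, \<rho>\<^sub>2). \<rho>\<^sub>1 \<in> density_matrices \<and> \<rho>\<^sub>2 \<in> density_matrices \<and> \<rho>\<^sub>1 \<noteq> \<rho>\<^sub>2}.
        ereal (trace_norm (\<Psi> \<rho>\<^sub>1 - \<Psi> \<rho>\<^sub>2) / trace_norm (\<rho>\<^sub>1 - \<rho>\<^sub>2)))"
      by (rule SUP_upper2[of "(rank_one a, rank_one b)"])
        (use gap_le_trace_norm_ratio[OF ab Z] in \<open>auto simp: c_def\<close>)
  qed
  ultimately show ?thesis
    unfolding attains_min_on_def min_value using inner outer ab by (intro conjI) (blast | simp)+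
qed

end
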